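(* Let $C>0$ be a constant for which the inner algorithm guarantee described in the context holds. There is a constant $c>0$ depending only on $C$ such that the following holds. Let $f\colon \mathbb{R}^{d_x}\times\mathbb{R}^{d_y}\to\mathbb{R}$ be a differentiable convex function that is $(L_x,L_y)$-smooth and $(\mu_x,\mu_y)$-strongly convex with $L_x,L_y,\mu_x,\mu_y>0$ and $\mu_x<L_x$, let $(x^*,y^* )$ be its minimizer, and let $\varepsilon\in(0,1/2]$. Run the Block Accelerated Method (BAM) with $$\alpha=\sqrt{\frac{\mu_x}{L_x}},\qquad \eta_x=\frac{1}{\sqrt{\mu_xL_x}},\qquad \eta_y=\frac{1}{\mu_y}\sqrt{\frac{\mu_x}{L_x}},$$ computing each $\overline{y}^{k+1}$ in step 2 by the inner algorithm. Then an $\varepsilon$-accurate solution of $\min_{x,y}f(x,y)$ is found using at most $$c\sqrt{\frac{L_x}{\mu_x}}\log\frac1\varepsilon\quad\text{calculations of }\nabla_x f$$ and at most $$c\max\left\{\sqrt{\frac{L_x}{\mu_x}},\sqrt{\frac{L_y}{\mu_y}}\right\}\log\frac1\varepsilon\quad\text{calculations of }\nabla_y f.$$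
   Context: Norms and inner products are Euclidean. $\nabla_x f$ and $\nabla_y f$ denote the partial gradients of $f$ with respect to the blocks $x\in\mathbb{R}^{d_x}$ and $y\in\mathbb{R}^{d_y}$. $f$ is $(L_x,L_y)$-smooth if for all $x_1,x_2\in\mathbb{R}^{d_x}$, $y_1,y_2\in\mathbb{R}^{d_y}$: $$f(x_2,y_2)\le f(x_1,y_1)+\langle\nabla_x f(x_1,y_1),x_2-x_1\rangle+\langle\nabla_y f(x_1,y_1),y_2-y_1\rangle+\frac{L_x}{2}\|x_2-x_1\|^2+\frac{L_y}{2}\|y_2-y_1\|^2.$$ $f$ is $(\mu_x,\mu_y)$-strongly convex if for all $x_1,x_2\in\mathbb{R}^{d_x}$, $y_1,y_2\in\mathbb{R}^{d_y}$: $$f(x_2,y_2)\ge f(x_1,y_1)+\langle\nabla_x f(x_1,y_1),x_2-x_1\rangle+\langle\nabla_y f(x_1,y_1),y_2-y_1\rangle+\frac{\mu_x}{2}\|x_2-x_1\|^2+\frac{\mu_y}{2}\|y_2-y_1\|^2.$$ Block Accelerated Method (BAM), with parameters $\eta_x,\eta_y>0$, $\alpha\in(0,1)$ and input $x^0=\overline{x}^0\in\mathbb{R}^{d_x}$, $y^0=\overline{y}^0\in\mathbb{R}^{d_y}$. For $k=0,1,2,\dots$: 1. $\underline{x}^k=\alpha x^k+(1-\alpha)\overline{x}^k$ and $\underline{y}^k=\alpha y^k+(1-\alpha)\overline{y}^k$. 2. Find $\overline{y}^{k+1}\in\mathbb{R}^{d_y}$ such that $$\left\|\nabla_y f(\underline{x}^k,\overline{y}^{k+1})+(\eta_y\alpha)^{-1}(\overline{y}^{k+1}-\underline{y}^k)\right\|\le(\eta_y\alpha)^{-1}\|\overline{y}^{k+1}-\underline{y}^k\|.$$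 3. $\overline{x}^{k+1}=\underline{x}^k-\eta_x\alpha\nabla_x f(\underline{x}^k,\overline{y}^{k+1})$. 4. $x^{k+1}$ is defined (implicitly) by $x^{k+1}=x^k+\alpha(\underline{x}^k-x^{k+1})-\eta_x\nabla_x f(\underline{x}^k,\overline{y}^{k+1})$. 5. $y^{k+1}$ is defined (implicitly) by $y^{k+1}=y^k+\alpha(\overline{y}^{k+1}-y^{k+1})-\eta_y\nabla_y f(\underline{x}^k,\overline{y}^{k+1})$. Inner algorithm (known result, taken as given). Let $A^k(y)=f(\underline{x}^k,y)+\frac{1}{2\eta_y\alpha}\|y-\underline{y}^k\|^2$ and $\underline{y}^\star=\arg\min_{y}A^k(y)$. There is a universal constant $C>0$ and an algorithm which, started at $\underline{y}^k$ and allowed $T\ge1$ evaluations of $\nabla A^k$, returns $\overline{y}^{k+1}$ with $$\|\nabla A^k(\overline{y}^{k+1})\|\le\frac{C\max\{L_y,(\eta_y\alpha)^{-1}\}\|\underline{y}^k-\underline{y}^\star\|}{T^2}.$$ In each BAM iteration it is run with $T$ equal to the smallest integer that is at least $\max\{1,\sqrt{2C}\max\{1,\sqrt{\eta_y\alpha L_y}\}\}$. Each evaluation of $\nabla A^k$ uses one calculation of $\nabla_y f$. In addition, each BAM iteration calculates $\nabla_x f$ and $\nabla_y f$ once at $(\underline{x}^k,\overline{y}^{k+1})$. $\varepsilon$-accurate (relative precision $\varepsilon$) means that the number $K$ of BAM iterations performed guarantees $\Psi^K\le\varepsilon\Psi^0$, where $$\Psi^k=(1+\alpha)\left(\eta_x^{-1}\|x^k-x^*\|^2+\eta_y^{-1}\|y^k-y^*\|^2\right)+\frac{2}{\alpha}\left(f(\overline{x}^k,\overline{y}^k)-f(x^*,y^*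 )\right).$$ *)

theory Defs
  imports Complex_Main "Jordan_Normal_Form.Matrix"
begin

text \<open>
  The Euclidean space of dimension \<open>d\<close> is \<^term>\<open>carrier_vec d :: real vec set\<close>, so that dimensions are
  ordinary natural numbers and a constant can be required to be the same for all dimensions.
  A function of the two blocks has type \<^typ>\<open>real vec \<Rightarrow> real vec \<Rightarrow> real\<close>; only its values on
  \<open>carrier_vec dx\<close> and \<open>carrier_vec dy\<close> matter.
\<close>

definition vnorm :: "real vec \<Rightarrow> real" where
  "vnorm v = sqrt (v \<bullet> v)"

text \<open>\<open>f\<close> is (Frechet) differentiable in the pair of blocks, with partial gradients \<open>gx\<close> and \<open>gy\<close>.\<close>

definition has_gradients ::
  "nat \<Rightarrow> nat \<Rightarrow> (real vec \<Rightarrow> real vec \<Rightarrow> real) \<Rightarrow> (real vec \<Rightarrow> real vec \<Rightarrow> real vec)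
    \<Rightarrow> (real vec \<Rightarrow> real vec \<Rightarrow> real vec) \<Rightarrow> bool" where
  "has_gradients dx dy f gx gy \<longleftrightarrow>
    (\<forall>x\<in>carrier_vec dx. \<forall>y\<in>carrier_vec dy.
      gx x y \<in> carrier_vec dx \<and> gy x y \<in> carrier_vec dy \<and>
      (\<forall>e>0. \<exists>\<delta>>0. \<forall>h\<in>carrier_vec dx. \<forall>k\<in>carrier_vec dy.
        sqrt ((vnorm h)\<^sup>2 + (vnorm k)\<^sup>2) < \<delta> \<longrightarrow>
        \<bar>f (x + h) (y + k) - f x y - gx x y \<bullet> h - gy x y \<bullet> k\<bar>
          \<le> e * sqrt ((vnorm h)\<^sup>2 + (vnorm k)\<^sup>2)))"

definition block_convex :: "nat \<Rightarrow> nat \<Rightarrow> (real vec \<Rightarrow> real vec \<Rightarrow> real) \<Rightarrow> bool" where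
  "block_convex dx dy f \<longleftrightarrow>
    (\<forall>x1\<in>carrier_vec dx. \<forall>x2\<in>carrier_vec dx. \<forall>y1\<in>carrier_vec dy. \<forall>y2\<in>carrier_vec dy. \<forall>t\<in>{0..1}.
      f (t \<cdot>\<^sub>v x1 + (1 - t) \<cdot>\<^sub>v x2) (t \<cdot>\<^sub>v y1 + (1 - t) \<cdot>\<^sub>v y2) \<le> t * f x1 y1 + (1 - t) * f x2 y2)"

definition block_smooth ::
  "nat \<Rightarrow> nat \<Rightarrow> real \<Rightarrow> real \<Rightarrow> (real vec \<Rightarrow> real vec \<Rightarrow> real) \<Rightarrow> (real vec \<Rightarrow> real vec \<Rightarrow> real vec)
    \<Rightarrow> (real vec \<Rightarrow> real vec \<Rightarrow> real vec) \<Rightarrow> bool" where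
  "block_smooth dx dy Lx Ly f gx gy \<longleftrightarrow>
    (\<forall>x1\<in>carrier_vec dx. \<forall>x2\<in>carrier_vec dx. \<forall>y1\<in>carrier_vec dy. \<forall>y2\<in>carrier_vec dy.
      f x2 y2 \<le> f x1 y1 + gx x1 y1 \<bullet> (x2 - x1) + gy x1 y1 \<bullet> (y2 - y1)
        + Lx / 2 * (vnorm (x2 - x1))\<^sup>2 + Ly / 2 * (vnorm (y2 - y1))\<^sup>2)"

definition block_strongly_convex ::
  "nat \<Rightarrow> nat \<Rightarrow> real \<Rightarrow> real \<Rightarrow> (real vec \<Rightarrow> real vec \<Rightarrow> real) \<Rightarrow> (real vec \<Rightarrow> real vec \<Rightarrow> real vec)
    \<Rightarrow> (real vec \<Rightarrow> real vec \<Rightarrow> real vec) \<Rightarrow> bool" where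
  "block_strongly_convex dx dy \<mu>x \<mu>y f gx gy \<longleftrightarrow>
    (\<forall>x1\<in>carrier_vec dx. \<forall>x2\<in>carrier_vec dx. \<forall>y1\<in>carrier_vec dy. \<forall>y2\<in>carrier_vec dy.
      f x2 y2 \<ge> f x1 y1 + gx x1 y1 \<bullet> (x2 - x1) + gy x1 y1 \<bullet> (y2 - y1)
        + \<mu>x / 2 * (vnorm (x2 - x1))\<^sup>2 + \<mu>y / 2 * (vnorm (y2 - y1))\<^sup>2)"

definition admissible ::
  "nat \<Rightarrow> nat \<Rightarrow> real \<Rightarrow> real \<Rightarrow> real \<Rightarrow> real \<Rightarrow> (real vec \<Rightarrow> real vec \<Rightarrow> real)
    \<Rightarrow> (real vec \<Rightarrow> real vec \<Rightarrow> real vec) \<Rightarrow> (real vec \<Rightarrow> real vec \<Rightarrow> real vec) \<Rightarrow> bool" where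
  "admissible dx dy Lx Ly \<mu>x \<mu>y f gx gy \<longleftrightarrow>
    Lx > 0 \<and> Ly > 0 \<and> \<mu>x > 0 \<and> \<mu>y > 0 \<and> \<mu>x < Lx \<and>
    has_gradients dx dy f gx gy \<and> block_convex dx dy f \<and>
    block_smooth dx dy Lx Ly f gx gy \<and> block_strongly_convex dx dy \<mu>x \<mu>y f gx gy"

text \<open>
  A deterministic first-order algorithm, as a decision tree: it either stops with a point, or asks
  for the gradient at a point and continues depending on the answer. It is run on a gradient oracle
  \<open>g\<close>, and \<open>evaluations\<close> counts the oracle calls made.
\<close>

datatype oracle_alg = Stop "real vec" | Ask "real vec" "real vec \<Rightarrow> oracle_alg"

primrec result :: "(real vec \<Rightarrow> real vec) \<Rightarrow> oracle_alg \<Rightarrow> real vec" where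
  "result g (Stop y) = y"
| "result g (Ask y cont) = result g (cont (g y))"

primrec evaluations :: "(real vec \<Rightarrow> real vec) \<Rightarrow> oracle_alg \<Rightarrow> nat" where
  "evaluations g (Stop y) = 0"
| "evaluations g (Ask y cont) = Suc (evaluations g (cont (g y)))"

text \<open>
  \<open>inner_obj f xu yu (\<eta>y * \<alpha>)\<close> is the function \<open>A\<^sup>k\<close> for \<open>xu\<close>, \<open>yu\<close> the underlined points, and
  \<open>inner_grad gy xu yu (\<eta>y * \<alpha>)\<close> is its gradient; one value of it takes one value of \<open>gy\<close>.
\<close>

definition inner_obj ::
  "(real vec \<Rightarrow> real vec \<Rightarrow> real) \<Rightarrow> real vec \<Rightarrow> real vec \<Rightarrow> real \<Rightarrow> real vec \<Rightarrow> real" where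
  "inner_obj f xu yu \<beta> y = f xu y + 1 / (2 * \<beta>) * (vnorm (y - yu))\<^sup>2"

definition inner_grad ::
  "(real vec \<Rightarrow> real vec \<Rightarrow> real vec) \<Rightarrow> real vec \<Rightarrow> real vec \<Rightarrow> real \<Rightarrow> real vec \<Rightarrow> real vec" where
  "inner_grad gy xu yu \<beta> y = gy xu y + inverse \<beta> \<cdot>\<^sub>v (y - yu)"

text \<open>
  An inner algorithm receives \<open>L\<^sub>y\<close>, the product \<open>\<eta>\<^sub>y \<alpha>\<close>, the starting point and the budget \<open>T\<close>.
  The constant \<open>C\<close> is uniform over all dimensions, objectives and parameters.
\<close>

definition inner_guarantee ::
  "real \<Rightarrow> (real \<Rightarrow> real \<Rightarrow> real vec \<Rightarrow> nat \<Rightarrow> oracle_alg) \<Rightarrow> bool" where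
  "inner_guarantee C inner \<longleftrightarrow>
    (\<forall>dx dy Lx Ly \<mu>x \<mu>y f gx gy. \<forall>\<eta>y>0. \<forall>\<alpha>\<in>{0<..<1}. \<forall>xu\<in>carrier_vec dx. \<forall>yu\<in>carrier_vec dy. \<forall>T\<ge>1.
      admissible dx dy Lx Ly \<mu>x \<mu>y f gx gy \<longrightarrow>
      (let g = inner_grad gy xu yu (\<eta>y * \<alpha>);
           P = inner Ly (\<eta>y * \<alpha>) yu T;
           yb = result g P
       in evaluations g P \<le> T \<and> yb \<in> carrier_vec dy \<and>
          (\<forall>ystar. is_arg_min (inner_obj f xu yu (\<eta>y * \<alpha>)) (\<lambda>y. y \<in> carrier_vec dy) ystar \<longrightarrow>
            vnorm (g yb) \<le> C * max Ly (inverse (\<eta>y * \<alpha>)) * vnorm (yu - ystar) / (real T)\<^sup>2)))"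

definition inner_budget :: "real \<Rightarrow> real \<Rightarrow> real \<Rightarrow> nat" where
  "inner_budget C Ly \<beta> = nat \<lceil>max 1 (sqrt (2 * C) * max 1 (sqrt (\<beta> * Ly)))\<rceil>"

text \<open>
  A state of BAM consists of the iterates and of the numbers of calculations of the two partial
  gradients made so far.
\<close>

record bam_state =
  xk :: "real vec"
  xbar :: "real vec"
  yk :: "real vec"
  ybar :: "real vec"
  calcs_x :: nat
  calcs_y :: nat

definition x_under :: "real \<Rightarrow> bam_state \<Rightarrow> real vec" where
  "x_under \<alpha> s = \<alpha> \<cdot>\<^sub>v xk s + (1 - \<alpha>) \<cdot>\<^sub>v xbar s"

definition y_under :: "real \<Rightarrow> bam_state \<Rightarrow> real vec" where
  "y_under \<alpha> s = \<alpha> \<cdot>\<^sub>v yk s + (1 - \<alpha>) \<cdot>\<^sub>v ybar s"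

text \<open>
  The condition that BAM imposes on the point \<open>ybar s'\<close> of the next state \<open>s'\<close>. It is not part of
  the assumptions on a run (where this point is the result of the inner algorithm).
\<close>

definition bam_criterion ::
  "(real vec \<Rightarrow> real vec \<Rightarrow> real vec) \<Rightarrow> real \<Rightarrow> real \<Rightarrow> bam_state \<Rightarrow> bam_state \<Rightarrow> bool" where
  "bam_criterion gy \<eta>y \<alpha> s s' \<longleftrightarrow>
    vnorm (gy (x_under \<alpha> s) (ybar s') + inverse (\<eta>y * \<alpha>) \<cdot>\<^sub>v (ybar s' - y_under \<alpha> s))
      \<le> inverse (\<eta>y * \<alpha>) * vnorm (ybar s' - y_under \<alpha> s)"

definition bam_step ::
  "nat \<Rightarrow> nat \<Rightarrow> (real vec \<Rightarrow> real vec \<Rightarrow> real vec) \<Rightarrow> (real vec \<Rightarrow> real vec \<Rightarrow> real vec)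
    \<Rightarrow> (real \<Rightarrow> real \<Rightarrow> real vec \<Rightarrow> nat \<Rightarrow> oracle_alg) \<Rightarrow> real \<Rightarrow> real \<Rightarrow> real \<Rightarrow> real \<Rightarrow> real
    \<Rightarrow> bam_state \<Rightarrow> bam_state \<Rightarrow> bool" where
  "bam_step dx dy gx gy inner C Ly \<eta>x \<eta>y \<alpha> s s' \<longleftrightarrow>
    (let xu = x_under \<alpha> s;
         yu = y_under \<alpha> s;
         g = inner_grad gy xu yu (\<eta>y * \<alpha>);
         P = inner Ly (\<eta>y * \<alpha>) yu (inner_budget C Ly (\<eta>y * \<alpha>))
     in ybar s' = result g P \<and>
        xbar s' = xu - (\<eta>x * \<alpha>) \<cdot>\<^sub>v gx xu (ybar s') \<and>
        xk s' \<in> carrier_vec dx \<and>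
        xk s' = xk s + \<alpha> \<cdot>\<^sub>v (xu - xk s') - \<eta>x \<cdot>\<^sub>v gx xu (ybar s') \<and>
        yk s' \<in> carrier_vec dy \<and>
        yk s' = yk s + \<alpha> \<cdot>\<^sub>v (ybar s' - yk s') - \<eta>y \<cdot>\<^sub>v gy xu (ybar s') \<and>
        calcs_x s' = calcs_x s + 1 \<and>
        calcs_y s' = calcs_y s + evaluations g P + 1)"

definition bam_run ::
  "nat \<Rightarrow> nat \<Rightarrow> (real vec \<Rightarrow> real vec \<Rightarrow> real vec) \<Rightarrow> (real vec \<Rightarrow> real vec \<Rightarrow> real vec)
    \<Rightarrow> (real \<Rightarrow> real \<Rightarrow> real vec \<Rightarrow> nat \<Rightarrow> oracle_alg) \<Rightarrow> real \<Rightarrow> real \<Rightarrow> real \<Rightarrow> real \<Rightarrow> real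
    \<Rightarrow> (nat \<Rightarrow> bam_state) \<Rightarrow> bool" where
  "bam_run dx dy gx gy inner C Ly \<eta>x \<eta>y \<alpha> s \<longleftrightarrow>
    xk (s 0) \<in> carrier_vec dx \<and> xbar (s 0) = xk (s 0) \<and>
    yk (s 0) \<in> carrier_vec dy \<and> ybar (s 0) = yk (s 0) \<and>
    calcs_x (s 0) = 0 \<and> calcs_y (s 0) = 0 \<and>
    (\<forall>k. bam_step dx dy gx gy inner C Ly \<eta>x \<eta>y \<alpha> (s k) (s (Suc k)))"

definition potential ::
  "(real vec \<Rightarrow> real vec \<Rightarrow> real) \<Rightarrow> real vec \<Rightarrow> real vec \<Rightarrow> real \<Rightarrow> real \<Rightarrow> real \<Rightarrow> bam_state \<Rightarrow> real" where
  "potential f xs ys \<eta>x \<eta>y \<alpha> s =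
    (1 + \<alpha>) * (inverse \<eta>x * (vnorm (xk s - xs))\<^sup>2 + inverse \<eta>y * (vnorm (yk s - ys))\<^sup>2)
      + 2 / \<alpha> * (f (xbar s) (ybar s) - f xs ys)"

end

theory Submission
  imports Defs "HOL-Analysis.L2_Norm"
begin

text \<open>
  Each BAM step contracts the potential by the factor \<open>1 + \<alpha>\<close>. Strong convexity at the point
  \<open>(x_under, ybar')\<close> towards the minimizer and convexity towards \<open>(xbar, ybar)\<close> bound the inner products
  produced by the two implicit (proximal) updates; the leftover \<open>\<eta>x \<parallel>gx\<parallel>\<^sup>2\<close> is paid for by the descent
  of the gradient step of size \<open>\<eta>x \<alpha> = 1 / Lx\<close>, and \<open>\<eta>y \<parallel>gy\<parallel>\<^sup>2\<close> by the criterion on \<open>ybar'\<close>. The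
  criterion itself follows from the budget, which makes the final inner gradient at most \<open>1 / (2 \<beta>)\<close> times
  the distance of the starting point to the minimizer of the \<open>1 / \<beta>\<close>-strongly convex inner objective,
  where \<open>\<beta> = \<eta>y \<alpha>\<close>. As \<open>\<beta> Ly = \<alpha>\<^sup>2 Ly / \<mu>y\<close>, a step costs
  \<open>O(max 1 (\<alpha> sqrt (Ly / \<mu>y)))\<close> calculations of \<open>gy\<close>, and \<open>O(ln (1 / \<epsilon>) / \<alpha>)\<close> steps suffice.
\<close>

section \<open>Euclidean norm and inner product in coordinates\<close>

lemma scalar_prod_sum:
  assumes "w \<in> carrier_vec d"
  shows "v \<bullet> w = (\<Sum>i<d. v $ i * w $ i)"
  using assms by (simp add: scalar_prod_def atLeast0LessThan carrier_vecD)

text \<open>Passing to \<open>L2_set\<close> over the coordinates gives access to its Cauchy-Schwarz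
  and triangle inequalities.\<close>

lemma vnorm_sum:
  assumes "v \<in> carrier_vec d"
  shows "vnorm v = L2_set (($) v) {..<d}"
  using assms by (simp add: vnorm_def L2_set_def scalar_prod_sum[OF assms] power2_eq_square)

lemma vnorm_sq_sum:
  assumes "v \<in> carrier_vec d"
  shows "(vnorm v)\<^sup>2 = (\<Sum>i<d. (v $ i)\<^sup>2)"
  by (simp add: vnorm_sum[OF assms] L2_set_def sum_nonneg)

lemma vnorm_nonneg: "vnorm v \<ge> 0"
  by (simp add: vnorm_sum[OF carrier_vec_dim_vec] L2_set_nonneg)

lemma scalar_prod_le_vnorm:
  assumes "v \<in> carrier_vec d" "w \<in> carrier_vec d"
  shows "\<bar>v \<bullet> w\<bar> \<le> vnorm v * vnorm w"
proof -
  have "\<bar>v \<bullet> w\<bar> \<le> (\<Sum>i<d. \<bar>v $ i\<bar> * \<bar>w $ i\<bar>)"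
    unfolding scalar_prod_sum[OF assms(2)] by (rule order_trans[OF sum_abs]) (simp add: abs_mult)
  also have "\<dots> \<le> vnorm v * vnorm w"
    unfolding vnorm_sum[OF assms(1)] vnorm_sum[OF assms(2)] by (rule L2_set_mult_ineq)
  finally show ?thesis .
qed

lemma vnorm_minus_triangle:
  assumes "u \<in> carrier_vec d" "v \<in> carrier_vec d" "w \<in> carrier_vec d"
  shows "vnorm (u - w) \<le> vnorm (v - u) + vnorm (w - v)"
proof -
  have "vnorm (u - w) = L2_set (\<lambda>i. (v - u) $ i + (w - v) $ i) {..<d}"
    unfolding vnorm_sum[OF minus_carrier_vec[OF assms(1,3)]] L2_set_def
    using assms by (intro arg_cong[where f=sqrt] sum.cong) (auto simp: power2_commute)
  also have "\<dots> \<le> vnorm (v - u) + vnorm (w - v)"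
    unfolding vnorm_sum[OF minus_carrier_vec[OF assms(2,1)]] vnorm_sum[OF minus_carrier_vec[OF assms(3,2)]]
    by (rule L2_set_triangle_ineq)
  finally show ?thesis .
qed

lemma vnorm_minus_commute:
  assumes "u \<in> carrier_vec d" "v \<in> carrier_vec d"
  shows "vnorm (u - v) = vnorm (v - u)"
  unfolding vnorm_sum[OF minus_carrier_vec[OF assms]] vnorm_sum[OF minus_carrier_vec[OF assms(2,1)]] L2_set_def
  using assms by (intro arg_cong[where f=sqrt] sum.cong) (auto simp: power2_commute)

lemma scalar_prod_self_vnorm: "v \<bullet> v = (vnorm v)\<^sup>2"
  unfolding vnorm_sq_sum[OF carrier_vec_dim_vec] scalar_prod_sum[OF carrier_vec_dim_vec]
  by (simp add: power2_eq_square)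

lemma vnorm_sq_smult: "(vnorm (c \<cdot>\<^sub>v v))\<^sup>2 = c\<^sup>2 * (vnorm v)\<^sup>2"
  unfolding scalar_prod_self_vnorm[symmetric]
  by (simp add: smult_scalar_prod_distrib[of _ "dim_vec v"] scalar_prod_smult_distrib[of _ "dim_vec v"]
      power2_eq_square)

lemma vnorm_sq_add_smult:
  assumes "v \<in> carrier_vec d" "w \<in> carrier_vec d"
  shows "(vnorm (v + c \<cdot>\<^sub>v w))\<^sup>2 = (vnorm v)\<^sup>2 + 2 * c * (v \<bullet> w) + c\<^sup>2 * (vnorm w)\<^sup>2"
proof -
  have vw: "v + c \<cdot>\<^sub>v w \<in> carrier_vec d" using assms by simp
  show ?thesis
    unfolding vnorm_sq_sum[OF assms(1)] vnorm_sq_sum[OF assms(2)] vnorm_sq_sum[OF vw] scalar_prod_sum[OF assms(2)]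
      sum_distrib_left sum.distrib[symmetric]
    using assms by (intro sum.cong) (auto simp: power2_eq_square algebra_simps)
qed

section \<open>Minimizers of strongly convex functions\<close>

lemma vnorm_lim_zero:
  assumes z: "\<And>n. z n \<in> carrier_vec d" and lim: "\<And>i. i < d \<Longrightarrow> (\<lambda>n. z n $ i) \<longlonglongrightarrow> 0"
  shows "(\<lambda>n. vnorm (z n)) \<longlonglongrightarrow> 0"
proof -
  have "(\<lambda>n. L2_set (($) (z n)) {..<d}) \<longlonglongrightarrow> sqrt (\<Sum>i<d. 0\<^sup>2)"
    unfolding L2_set_def by (intro tendsto_intros) (use lim in auto)
  then show ?thesis using vnorm_sum[OF z] by simp
qed

text \<open>
  Strong convexity makes every minimizing sequence Cauchy (compare its values with those at the
  midpoints), so no compactness is needed.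
\<close>

lemma strongly_convex_has_minimizer:
  fixes A :: "real vec \<Rightarrow> real"
  assumes m: "m > 0"
    and G: "\<And>u. u \<in> carrier_vec d \<Longrightarrow> G u \<in> carrier_vec d"
    and SC: "\<And>u v. u \<in> carrier_vec d \<Longrightarrow> v \<in> carrier_vec d \<Longrightarrow>
      A v \<ge> A u + G u \<bullet> (v - u) + m / 2 * (vnorm (v - u))\<^sup>2"
  shows "\<exists>y. is_arg_min A (\<lambda>y. y \<in> carrier_vec d) y"
proof -
  define I where "I = (INF y \<in> carrier_vec d. A y)"
  have bdd: "bdd_below (A ` carrier_vec d)"
  proof (rule bdd_belowI2)
    fix v :: "real vec" assume v: "v \<in> carrier_vec d"
    let ?w = "v - 0\<^sub>v d" and ?g = "vnorm (G (0\<^sub>v d))"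
    have "- (?g * vnorm ?w) \<le> G (0\<^sub>v d) \<bullet> ?w"
      using scalar_prod_le_vnorm[of "G (0\<^sub>v d)" d ?w] G v by simp
    \<comment> \<open>Completing the square: \<open>m / 2 * t^2 - ?g * t\<close> is at least
      \<open>- ?g^2 / (2 * m)\<close> for every real \<open>t\<close>.\<close>
    moreover have "0 \<le> (m * vnorm ?w - ?g)\<^sup>2 / (2 * m)"
      using m by simp
    then have "?g * vnorm ?w - ?g\<^sup>2 / (2 * m) \<le> m / 2 * (vnorm ?w)\<^sup>2"
      using m by (simp add: field_simps power2_eq_square)
    ultimately show "A (0\<^sub>v d) - ?g\<^sup>2 / (2 * m) \<le> A v"
      using SC[of "0\<^sub>v d" v] v by auto
  qed
  have I_le: "I \<le> A v" if "v \<in> carrier_vec d" for v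
    unfolding I_def by (rule cINF_lower[OF bdd that])
  have "\<exists>y \<in> carrier_vec d. A y < I + inverse (real (Suc n))" for n
  proof (rule ccontr)
    assume "\<not> ?thesis"
    then have "I + inverse (real (Suc n)) \<le> I"
      unfolding I_def[symmetric] by (subst (2) I_def, intro cINF_greatest) (auto simp: not_less intro: zero_carrier_vec)
    then show False by simp
  qed
  then obtain y where y: "\<And>n. y n \<in> carrier_vec d" "\<And>n. A (y n) < I + inverse (real (Suc n))"
    by metis
  \<comment> \<open>Strong convexity is applied from the midpoint to \<open>u\<close> and to
    \<open>v\<close>. The two linear terms cancel, and each quadratic term is \<open>m / 8\<close>
    times the squared distance.\<close>
  have gap: "m / 4 * (vnorm (u - v))\<^sup>2 \<le> A u + A v - 2 * I"
    if uv: "u \<in> carrier_vec d" "v \<in> carrier_vec d" for u v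
  proof -
    let ?c = "(1/2) \<cdot>\<^sub>v (u + v)"
    have c: "?c \<in> carrier_vec d" using uv by simp
    have e1: "u - ?c = (1/2) \<cdot>\<^sub>v (u - v)" and e2: "v - ?c = (-1/2) \<cdot>\<^sub>v (u - v)"
      using uv by (auto intro!: eq_vecI simp: field_simps)
    have s: "G ?c \<bullet> (r \<cdot>\<^sub>v (u - v)) = r * (G ?c \<bullet> (u - v))" for r
      using uv G[OF c] by (intro scalar_prod_smult_distrib[of _ d]) auto
    show ?thesis
      using SC[OF c uv(1)] SC[OF c uv(2)] I_le[OF c]
      unfolding e1 e2 vnorm_sq_smult s by (simp add: power2_eq_square)
  qed
  have cauchy: "Cauchy (\<lambda>n. y n $ i)" if i: "i < d" for i
  proof (rule metric_CauchyI)
    fix e :: real assume e: "e > 0"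
    \<comment> \<open>Two values of \<open>A\<close>, each within \<open>m * e^2 / 8\<close> of the
      infimum, make the right side of \<open>gap\<close> smaller than
      \<open>m * e^2 / 4\<close>.\<close>
    obtain N where N: "inverse (real (Suc N)) < m * e\<^sup>2 / 8"
      using reals_Archimedean[of "m * e\<^sup>2 / 8"] m e by auto
    have "dist (y p $ i) (y q $ i) < e" if pq: "p \<ge> N" "q \<ge> N" for p q
    proof -
      have "inverse (real (Suc p)) \<le> inverse (real (Suc N))" "inverse (real (Suc q)) \<le> inverse (real (Suc N))"
        using pq by (auto intro!: le_imp_inverse_le)
      then have "m / 4 * (vnorm (y p - y q))\<^sup>2 < m / 4 * e\<^sup>2"
        using gap[OF y(1) y(1), of p q] y(2)[of p] y(2)[of q] N by linarith
      moreover have "(y p $ i - y q $ i)\<^sup>2 \<le> (vnorm (y p - y q))\<^sup>2"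
      proof -
        have "(y p $ i - y q $ i)\<^sup>2 = ((y p - y q) $ i)\<^sup>2"
          using i y(1)[of q] by simp
        also have "\<dots> \<le> (\<Sum>j<d. ((y p - y q) $ j)\<^sup>2)"
          by (rule member_le_sum) (use i in auto)
        finally show ?thesis
          using vnorm_sq_sum[OF minus_carrier_vec[OF y(1) y(1)]] by simp
      qed
      ultimately have "\<bar>y p $ i - y q $ i\<bar>\<^sup>2 < e\<^sup>2" using m by simp
      then show ?thesis unfolding dist_real_def using e power_less_imp_less_base by fastforce
    qed
    then show "\<exists>N. \<forall>p\<ge>N. \<forall>q\<ge>N. dist (y p $ i) (y q $ i) < e" by blast
  qed
  define ys where "ys = vec d (\<lambda>i. lim (\<lambda>n. y n $ i))"
  have ys: "ys \<in> carrier_vec d" by (simp add: ys_def)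
  have "(\<lambda>n. (y n - ys) $ i) \<longlonglongrightarrow> 0" if i: "i < d" for i
  proof -
    have "(\<lambda>n. y n $ i) \<longlonglongrightarrow> ys $ i"
      using cauchy[OF i] i by (simp add: ys_def convergent_LIMSEQ_iff[symmetric] real_Cauchy_convergent)
    then have "(\<lambda>n. y n $ i - ys $ i) \<longlonglongrightarrow> 0"
      by (simp add: LIM_zero_iff)
    then show ?thesis using y(1) ys i by simp
  qed
  then have lim: "(\<lambda>n. vnorm (y n - ys)) \<longlonglongrightarrow> 0"
    by (intro vnorm_lim_zero[of _ d]) (use y(1) ys in auto)
  \<comment> \<open>Continuity of \<open>A\<close> is not assumed. Strong convexity based at the
    limit \<open>ys\<close> bounds \<open>A ys\<close> from above by values along the
    sequence.\<close>
  have "A ys \<le> I + inverse (real (Suc n)) + vnorm (G ys) * vnorm (y n - ys)" for n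
  proof -
    have "- (vnorm (G ys) * vnorm (y n - ys)) \<le> G ys \<bullet> (y n - ys)"
      using scalar_prod_le_vnorm[of "G ys" d "y n - ys"] G ys y(1)[of n] by simp
    moreover have "0 \<le> m / 2 * (vnorm (y n - ys))\<^sup>2" using m by simp
    ultimately show ?thesis using SC[OF ys y(1)[of n]] y(2)[of n] by linarith
  qed
  moreover have "(\<lambda>n. I + inverse (real (Suc n)) + vnorm (G ys) * vnorm (y n - ys))
      \<longlonglongrightarrow> I + 0 + vnorm (G ys) * 0"
    by (intro tendsto_intros lim LIMSEQ_inverse_real_of_nat)
  ultimately have "A ys \<le> I"
    by (intro LIMSEQ_le_const[where X="\<lambda>n. I + inverse (real (Suc n)) + vnorm (G ys) * vnorm (y n - ys)"]) auto
  then show ?thesis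
    using ys I_le unfolding is_arg_min_def by (intro exI[of _ ys]) force
qed

text \<open>The gradient vanishes at \<open>z\<close>, since otherwise smoothness would make a
  gradient step from \<open>z\<close> decrease \<open>A\<close>. Adding strong convexity from
  \<open>y\<close> to \<open>z\<close> and from \<open>z\<close> to \<open>y\<close> then leaves
  only the inner product with \<open>G y\<close>, to which Cauchy-Schwarz applies.\<close>

lemma strongly_convex_dist_minimizer:
  fixes A :: "real vec \<Rightarrow> real"
  assumes L: "L > 0"
    and G: "\<And>u. u \<in> carrier_vec d \<Longrightarrow> G u \<in> carrier_vec d"
    and SC: "\<And>u v. u \<in> carrier_vec d \<Longrightarrow> v \<in> carrier_vec d \<Longrightarrow>
      A v \<ge> A u + G u \<bullet> (v - u) + m / 2 * (vnorm (v - u))\<^sup>2"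
    and smooth: "\<And>u v. u \<in> carrier_vec d \<Longrightarrow> v \<in> carrier_vec d \<Longrightarrow>
      A v \<le> A u + G u \<bullet> (v - u) + L / 2 * (vnorm (v - u))\<^sup>2"
    and min: "is_arg_min A (\<lambda>y. y \<in> carrier_vec d) z" and y: "y \<in> carrier_vec d"
  shows "m * vnorm (y - z) \<le> vnorm (G y)"
proof -
  have z: "z \<in> carrier_vec d" and le: "\<And>v. v \<in> carrier_vec d \<Longrightarrow> A z \<le> A v"
    using min unfolding is_arg_min_def by (auto simp: not_less)
  note Gz = G[OF z]
  \<comment> \<open>A step of length \<open>1 / L\<close> minimizes the quadratic upper bound and
    lowers it by the squared norm of \<open>G z\<close> divided by \<open>2 * L\<close>.\<close>
  define r where "r = - (1 / L)"
  have w: "z + r \<cdot>\<^sub>v G z \<in> carrier_vec d" using z Gz by simp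
  have e1: "z + r \<cdot>\<^sub>v G z - z = r \<cdot>\<^sub>v G z"
    using z Gz by (auto intro!: eq_vecI)
  have e2: "G z \<bullet> (r \<cdot>\<^sub>v G z) = r * (vnorm (G z))\<^sup>2"
    unfolding scalar_prod_smult_distrib[OF Gz Gz] scalar_prod_self_vnorm ..
  have "A z \<le> A z + r * (vnorm (G z))\<^sup>2 + L / 2 * (r\<^sup>2 * (vnorm (G z))\<^sup>2)"
    using order_trans[OF le[OF w] smooth[OF z w]] unfolding e1 e2 vnorm_sq_smult .
  then have "(vnorm (G z))\<^sup>2 \<le> 0"
    using L by (simp add: r_def power2_eq_square field_simps)
  then have "vnorm (G z) = 0" by simp
  then have "G z \<bullet> (y - z) = 0"
    using scalar_prod_le_vnorm[of "G z" d "y - z"] Gz y z by simp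
  then have "m * (vnorm (y - z))\<^sup>2 \<le> - (G y \<bullet> (z - y))"
    using SC[OF z y] SC[OF y z] vnorm_minus_commute[OF y z] by simp
  also have "\<dots> \<le> vnorm (G y) * vnorm (y - z)"
    using scalar_prod_le_vnorm[of "G y" d "z - y"] G y z vnorm_minus_commute[OF y z] by simp
  finally show ?thesis
    using vnorm_nonneg[of "y - z"] vnorm_nonneg[of "G y"]
    by (cases "vnorm (y - z) = 0") (auto simp: power2_eq_square)
qed

section \<open>The inner objective\<close>

lemma admissible_ineqs:
  assumes "admissible dx dy Lx Ly \<mu>x \<mu>y f gx gy"
    and "x1 \<in> carrier_vec dx" "x2 \<in> carrier_vec dx" "y1 \<in> carrier_vec dy" "y2 \<in> carrier_vec dy"
  shows "f x2 y2 \<le> f x1 y1 + gx x1 y1 \<bullet> (x2 - x1) + gy x1 y1 \<bullet> (y2 - y1)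
      + Lx / 2 * (vnorm (x2 - x1))\<^sup>2 + Ly / 2 * (vnorm (y2 - y1))\<^sup>2"
    and "f x2 y2 \<ge> f x1 y1 + gx x1 y1 \<bullet> (x2 - x1) + gy x1 y1 \<bullet> (y2 - y1)
      + \<mu>x / 2 * (vnorm (x2 - x1))\<^sup>2 + \<mu>y / 2 * (vnorm (y2 - y1))\<^sup>2"
  using assms unfolding admissible_def block_smooth_def block_strongly_convex_def by blast+

lemma inner_grad_carrier:
  assumes "admissible dx dy Lx Ly \<mu>x \<mu>y f gx gy" "xu \<in> carrier_vec dx" "yu \<in> carrier_vec dy" "y \<in> carrier_vec dy"
  shows "inner_grad gy xu yu \<beta> y \<in> carrier_vec dy"
  using assms unfolding admissible_def has_gradients_def inner_grad_def by simp

text \<open>The quadratic penalty expands exactly and contributes \<open>inverse \<beta>\<close> to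
  both constants. From \<open>f\<close> only convexity in the second block is kept for the lower
  bound, and \<open>Ly\<close> for the upper one.\<close>

lemma inner_obj_strongly_convex_smooth:
  fixes \<beta> :: real
  assumes adm: "admissible dx dy Lx Ly \<mu>x \<mu>y f gx gy"
    and c: "xu \<in> carrier_vec dx" "yu \<in> carrier_vec dy" "u \<in> carrier_vec dy" "v \<in> carrier_vec dy"
  defines "A \<equiv> inner_obj f xu yu \<beta>" and "G \<equiv> inner_grad gy xu yu \<beta>"
  shows "A v \<ge> A u + G u \<bullet> (v - u) + inverse \<beta> / 2 * (vnorm (v - u))\<^sup>2"
    and "A v \<le> A u + G u \<bullet> (v - u) + (Ly + inverse \<beta>) / 2 * (vnorm (v - u))\<^sup>2"
proof -
  have g: "gx xu u \<in> carrier_vec dx" "gy xu u \<in> carrier_vec dy"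
    using adm c unfolding admissible_def has_gradients_def by auto
  have x0: "gx xu u \<bullet> (xu - xu) = 0" "vnorm (xu - xu) = 0"
    using c g by (simp_all add: vnorm_def)
  define r where "r = 1 / (2 * \<beta>)"
  have r: "inverse \<beta> = 2 * r" by (simp add: r_def field_simps)
  have "r * (vnorm (v - yu))\<^sup>2 = r * ((vnorm (u - yu))\<^sup>2 + 2 * ((u - yu) \<bullet> (v - u)) + (vnorm (v - u))\<^sup>2)"
  proof -
    have "v - yu = (u - yu) + 1 \<cdot>\<^sub>v (v - u)" using c by (auto intro!: eq_vecI)
    then show ?thesis using vnorm_sq_add_smult[of "u - yu" dy "v - u" 1] c by simp
  qed
  moreover have "G u \<bullet> (v - u) = gy xu u \<bullet> (v - u) + 2 * r * ((u - yu) \<bullet> (v - u))"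
    using c g by (simp add: G_def inner_grad_def r add_scalar_prod_distrib[of _ dy] smult_scalar_prod_distrib[of _ dy])
  moreover have "f xu v \<ge> f xu u + gy xu u \<bullet> (v - u) + \<mu>y / 2 * (vnorm (v - u))\<^sup>2"
    and "f xu v \<le> f xu u + gy xu u \<bullet> (v - u) + Ly / 2 * (vnorm (v - u))\<^sup>2"
    using admissible_ineqs[OF adm c(1,1,3,4)] x0 by simp_all
  moreover have "\<mu>y / 2 * (vnorm (v - u))\<^sup>2 \<ge> 0"
    using adm by (simp add: admissible_def)
  ultimately show "A v \<ge> A u + G u \<bullet> (v - u) + inverse \<beta> / 2 * (vnorm (v - u))\<^sup>2"
    and "A v \<le> A u + G u \<bullet> (v - u) + (Ly + inverse \<beta>) / 2 * (vnorm (v - u))\<^sup>2"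
    unfolding A_def inner_obj_def r_def[symmetric] r by argo+
qed

section \<open>Contraction of the potential in one BAM step\<close>

text \<open>
  The update \<open>p\<close> minimizes \<open>2 \<langle>g, p\<rangle> + (p - a)\<^sup>2 / \<eta> + \<alpha> (p - b)\<^sup>2 / \<eta>\<close>; the difference of the two sides
  is \<open>(p - a + \<eta> g)\<^sup>2 / \<eta> + \<alpha> (p - b)\<^sup>2 / \<eta>\<close>.
\<close>

lemma prox_step_real:
  fixes p :: real
  assumes "\<alpha> > 0" "\<eta> > 0" and p: "p = a + \<alpha> * (b - p) - \<eta> * g"
  shows "(1 + \<alpha>) * (inverse \<eta> * (p - s)\<^sup>2) \<le>
    inverse \<eta> * (a - s)\<^sup>2 + \<alpha> / \<eta> * (s - b)\<^sup>2 + 2 * (g * (s - b))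
      + 2 * (1 - \<alpha>) / \<alpha> * (g * (r - b)) + 2 / \<alpha> * (g * (b - (\<alpha> * a + (1 - \<alpha>) * r))) + \<eta> * g\<^sup>2"
    (is "?l \<le> ?r")
proof -
  define h where "h = a + \<alpha> * (b - p) - p"
  have h: "g = h / \<eta>" using assms by (simp add: h_def field_simps)
  \<comment> \<open>The weights are chosen so that \<open>b\<close> and \<open>r\<close> drop out.
    Each product on the left is later controlled by its own inequality for \<open>f\<close> or by
    the criterion.\<close>
  have "2 * (g * (s - b)) + 2 * (1 - \<alpha>) / \<alpha> * (g * (r - b)) + 2 / \<alpha> * (g * (b - (\<alpha> * a + (1 - \<alpha>) * r)))
      = 2 * g * (s - a)"
    using assms(1) by (simp add: field_simps)
  then have "?r = inverse \<eta> * (a - s)\<^sup>2 + \<alpha> / \<eta> * (s - b)\<^sup>2 + 2 * g * (s - a) + \<eta> * g\<^sup>2"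
    by linarith
  then have "\<eta> * (?r - ?l) = (a - s)\<^sup>2 + \<alpha> * (s - b)\<^sup>2 + 2 * h * (s - a) + h\<^sup>2 - (1 + \<alpha>) * (p - s)\<^sup>2"
    using assms(2) by (simp only: h) (simp add: field_simps power2_eq_square)
  also have "\<dots> = (p - a + h)\<^sup>2 + \<alpha> * (p - b)\<^sup>2"
    by (simp add: h_def power2_eq_square algebra_simps)
  also have "\<dots> \<ge> 0" using assms(1) by simp
  finally show ?thesis using assms(2) by (simp add: zero_le_mult_iff)
qed

text \<open>Every term separates over coordinates, so the real inequality is summed. In both blocks
  \<open>a\<close> is the old iterate, \<open>r\<close> the old averaged point, \<open>s\<close> the
  minimizer and \<open>b\<close> the point where the gradient \<open>g\<close> is taken.\<close>

lemma prox_step: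
  assumes "\<alpha> > 0" "\<eta> > 0"
    and c: "p \<in> carrier_vec d" "a \<in> carrier_vec d" "b \<in> carrier_vec d" "r \<in> carrier_vec d"
      "s \<in> carrier_vec d" "g \<in> carrier_vec d"
    and p: "p = a + \<alpha> \<cdot>\<^sub>v (b - p) - \<eta> \<cdot>\<^sub>v g"
  shows "(1 + \<alpha>) * (inverse \<eta> * (vnorm (p - s))\<^sup>2) \<le>
    inverse \<eta> * (vnorm (a - s))\<^sup>2 + \<alpha> / \<eta> * (vnorm (s - b))\<^sup>2 + 2 * (g \<bullet> (s - b))
      + 2 * (1 - \<alpha>) / \<alpha> * (g \<bullet> (r - b)) + 2 / \<alpha> * (g \<bullet> (b - (\<alpha> \<cdot>\<^sub>v a + (1 - \<alpha>) \<cdot>\<^sub>v r))) + \<eta> * (vnorm g)\<^sup>2"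
proof -
  have u: "b - (\<alpha> \<cdot>\<^sub>v a + (1 - \<alpha>) \<cdot>\<^sub>v r) \<in> carrier_vec d" using c by simp
  note m = minus_carrier_vec
  have pi: "p $ i = a $ i + \<alpha> * (b $ i - p $ i) - \<eta> * g $ i" if "i < d" for i
    by (subst p) (use c that in simp)
  show ?thesis
    unfolding vnorm_sq_sum[OF m[OF c(1,5)]] vnorm_sq_sum[OF m[OF c(2,5)]] vnorm_sq_sum[OF m[OF c(5,3)]]
      vnorm_sq_sum[OF c(6)] scalar_prod_sum[OF m[OF c(5,3)]] scalar_prod_sum[OF m[OF c(4,3)]]
      scalar_prod_sum[OF u] sum_distrib_left sum.distrib[symmetric]
  proof (rule sum_mono)
    fix i assume "i \<in> {..<d}"
    then have i: "i < d" by simp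
    show "(1 + \<alpha>) * (inverse \<eta> * ((p - s) $ i)\<^sup>2) \<le>
      inverse \<eta> * ((a - s) $ i)\<^sup>2 + \<alpha> / \<eta> * ((s - b) $ i)\<^sup>2 + 2 * (g $ i * (s - b) $ i)
      + 2 * (1 - \<alpha>) / \<alpha> * (g $ i * (r - b) $ i)
      + 2 / \<alpha> * (g $ i * (b - (\<alpha> \<cdot>\<^sub>v a + (1 - \<alpha>) \<cdot>\<^sub>v r)) $ i) + \<eta> * (g $ i)\<^sup>2"
      using prox_step_real[OF assms(1,2) pi[OF i], of "s $ i" "r $ i"] c i by simp
  qed
qed

text \<open>Squaring the criterion cancels the squared norm of \<open>w\<close>; only the cross term
  and the squared norm of \<open>g\<close> survive.\<close>

lemma criterion_scalar_prod:
  assumes "\<beta> > 0" "g \<in> carrier_vec d" "w \<in> carrier_vec d"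
    and "vnorm (g + inverse \<beta> \<cdot>\<^sub>v w) \<le> inverse \<beta> * vnorm w"
  shows "g \<bullet> w \<le> - (\<beta> / 2) * (vnorm g)\<^sup>2"
proof -
  have "(vnorm (g + inverse \<beta> \<cdot>\<^sub>v w))\<^sup>2 \<le> (inverse \<beta> * vnorm w)\<^sup>2"
    using assms(4) vnorm_nonneg by (rule power_mono)
  then have "(vnorm g)\<^sup>2 + 2 * inverse \<beta> * (g \<bullet> w) \<le> 0"
    unfolding vnorm_sq_add_smult[OF assms(2,3)] by (simp add: power_mult_distrib)
  then show ?thesis using assms(1) by (simp add: field_simps)
qed

text \<open>The parameters enter through three identities:
  \<open>\<eta>x * \<alpha> = 1 / Lx\<close> fixes the gradient step in the first block, and the
  other two match the quadratic terms of the proximal updates with those of strong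
  convexity.\<close>

lemma bam_descent:
  assumes adm: "admissible dx dy Lx Ly \<mu>x \<mu>y f gx gy"
    and par: "0 < \<alpha>" "\<alpha> < 1" "\<eta>x > 0" "\<eta>y > 0" "\<eta>x * \<alpha> = 1 / Lx" "\<alpha> / \<eta>x = \<mu>x" "\<alpha> / \<eta>y = \<mu>y"
    and star: "xs \<in> carrier_vec dx" "ys \<in> carrier_vec dy"
      "\<And>x y. x \<in> carrier_vec dx \<Longrightarrow> y \<in> carrier_vec dy \<Longrightarrow> f xs ys \<le> f x y"
    and st: "xk s \<in> carrier_vec dx" "xbar s \<in> carrier_vec dx" "yk s \<in> carrier_vec dy" "ybar s \<in> carrier_vec dy"
    and st': "xk s' \<in> carrier_vec dx" "yk s' \<in> carrier_vec dy" "ybar s' \<in> carrier_vec dy"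
    and xbar': "xbar s' = x_under \<alpha> s - (\<eta>x * \<alpha>) \<cdot>\<^sub>v gx (x_under \<alpha> s) (ybar s')"
    and xk': "xk s' = xk s + \<alpha> \<cdot>\<^sub>v (x_under \<alpha> s - xk s') - \<eta>x \<cdot>\<^sub>v gx (x_under \<alpha> s) (ybar s')"
    and yk': "yk s' = yk s + \<alpha> \<cdot>\<^sub>v (ybar s' - yk s') - \<eta>y \<cdot>\<^sub>v gy (x_under \<alpha> s) (ybar s')"
    and crit: "bam_criterion gy \<eta>y \<alpha> s s'"
  shows "(1 + \<alpha>) * potential f xs ys \<eta>x \<eta>y \<alpha> s' \<le> potential f xs ys \<eta>x \<eta>y \<alpha> s"
proof -
  define xu where "xu = x_under \<alpha> s"
  define yu where "yu = y_under \<alpha> s"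
  define yb where "yb = ybar s'"
  define p where "p = gx xu yb"
  define q where "q = gy xu yb"
  have Lx: "Lx > 0" using adm by (simp add: admissible_def)
  have c: "xu \<in> carrier_vec dx" "yu \<in> carrier_vec dy" "yb \<in> carrier_vec dy"
    using st st' by (simp_all add: xu_def yu_def yb_def x_under_def y_under_def)
  then have pq: "p \<in> carrier_vec dx" "q \<in> carrier_vec dy"
    using adm by (auto simp: p_def q_def admissible_def has_gradients_def)
  have xb: "xbar s' = xu - (1 / Lx) \<cdot>\<^sub>v p" using xbar' par by (simp add: xu_def p_def yb_def)
  have z: "p \<bullet> (xu - xu) = 0" "q \<bullet> (yb - yb) = 0" "vnorm (yb - yb) = 0"
    using pq c by (simp_all add: vnorm_def)
  \<comment> \<open>In this block the gradient point is the underlined point itself, so the product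
    with weight \<open>2 / \<alpha>\<close> is zero.\<close>
  have X: "(1 + \<alpha>) * (inverse \<eta>x * (vnorm (xk s' - xs))\<^sup>2) \<le>
      inverse \<eta>x * (vnorm (xk s - xs))\<^sup>2 + \<mu>x * (vnorm (xs - xu))\<^sup>2 + 2 * (p \<bullet> (xs - xu))
      + 2 * (1 - \<alpha>) / \<alpha> * (p \<bullet> (xbar s - xu)) + \<eta>x * (vnorm p)\<^sup>2"
    using prox_step[OF par(1,3) st'(1) st(1) c(1) st(2) star(1) pq(1)] xk' z(1) par(6)
    by (simp add: xu_def p_def yb_def x_under_def)
  have Y: "(1 + \<alpha>) * (inverse \<eta>y * (vnorm (yk s' - ys))\<^sup>2) \<le>
      inverse \<eta>y * (vnorm (yk s - ys))\<^sup>2 + \<mu>y * (vnorm (ys - yb))\<^sup>2 + 2 * (q \<bullet> (ys - yb))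
      + 2 * (1 - \<alpha>) / \<alpha> * (q \<bullet> (ybar s - yb)) + 2 / \<alpha> * (q \<bullet> (yb - yu)) + \<eta>y * (vnorm q)\<^sup>2"
    using prox_step[OF par(1,4) st'(2) st(3) c(3) st(4) star(2) pq(2)] yk' par(7)
    by (simp add: xu_def q_def yb_def yu_def y_under_def)
  have "q \<bullet> (yb - yu) \<le> - (\<eta>y * \<alpha> / 2) * (vnorm q)\<^sup>2"
    by (rule criterion_scalar_prod[of _ _ dy])
      (use par pq c crit in \<open>auto simp: bam_criterion_def q_def xu_def yu_def yb_def\<close>)
  then have "2 / \<alpha> * (q \<bullet> (yb - yu)) \<le> 2 / \<alpha> * (- (\<eta>y * \<alpha> / 2) * (vnorm q)\<^sup>2)"
    using par by (intro mult_left_mono) auto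
  \<comment> \<open>With \<open>\<beta> = \<eta>y * \<alpha>\<close> the criterion yields exactly
    \<open>\<eta>y\<close> times the squared norm of \<open>q\<close>.\<close>
  then have Q: "2 / \<alpha> * (q \<bullet> (yb - yu)) + \<eta>y * (vnorm q)\<^sup>2 \<le> 0"
    using par(1) by simp
  \<comment> \<open>Strong convexity is doubled so that its linear and quadratic terms cancel those
    in \<open>X\<close> and \<open>Y\<close>.\<close>
  have S: "2 * f xs ys \<ge> 2 * f xu yb + 2 * (p \<bullet> (xs - xu)) + 2 * (q \<bullet> (ys - yb))
      + \<mu>x * (vnorm (xs - xu))\<^sup>2 + \<mu>y * (vnorm (ys - yb))\<^sup>2"
    using admissible_ineqs(2)[OF adm c(1) star(1) c(3) star(2)] unfolding p_def[symmetric] q_def[symmetric] by argo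
  have "f (xbar s) (ybar s) \<ge> f xu yb + p \<bullet> (xbar s - xu) + q \<bullet> (ybar s - yb)
      + \<mu>x / 2 * (vnorm (xbar s - xu))\<^sup>2 + \<mu>y / 2 * (vnorm (ybar s - yb))\<^sup>2"
    using admissible_ineqs(2)[OF adm c(1) st(2) c(3) st(4)] unfolding p_def[symmetric] q_def[symmetric] .
  moreover have "\<mu>x / 2 * (vnorm (xbar s - xu))\<^sup>2 \<ge> 0" "\<mu>y / 2 * (vnorm (ybar s - yb))\<^sup>2 \<ge> 0"
    using adm by (simp_all add: admissible_def)
  ultimately have "p \<bullet> (xbar s - xu) + q \<bullet> (ybar s - yb) \<le> f (xbar s) (ybar s) - f xu yb"
    by linarith
  then have "2 * (1 - \<alpha>) / \<alpha> * (p \<bullet> (xbar s - xu) + q \<bullet> (ybar s - yb))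
      \<le> 2 * (1 - \<alpha>) / \<alpha> * (f (xbar s) (ybar s) - f xu yb)"
    using par by (intro mult_left_mono) auto
  then have T: "2 * (1 - \<alpha>) / \<alpha> * (p \<bullet> (xbar s - xu)) + 2 * (1 - \<alpha>) / \<alpha> * (q \<bullet> (ybar s - yb))
      \<le> 2 * (1 - \<alpha>) / \<alpha> * (f (xbar s) (ybar s) - f xu yb)"
    by (simp add: distrib_left)
  have xbc: "xbar s' \<in> carrier_vec dx" using xb c pq by simp
  have d: "xbar s' - xu = (- (1 / Lx)) \<cdot>\<^sub>v p"
    using xb c pq by (auto intro!: eq_vecI)
  \<comment> \<open>The second block stays at \<open>yb\<close>, so the step costs only the
    \<open>Lx\<close> term.\<close>
  have "f (xbar s') yb \<le> f xu yb + p \<bullet> (xbar s' - xu) + Lx / 2 * (vnorm (xbar s' - xu))\<^sup>2"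
    using admissible_ineqs(1)[OF adm c(1) xbc c(3,3)] z(2,3) unfolding p_def[symmetric] q_def[symmetric] by simp
  also have "\<dots> = f xu yb - 1 / (2 * Lx) * (vnorm p)\<^sup>2"
    unfolding d vnorm_sq_smult using Lx pq
    by (simp add: scalar_prod_smult_distrib[of _ dx] scalar_prod_self_vnorm power2_eq_square field_simps)
  finally have "2 / \<alpha> * (f (xbar s') yb) \<le> 2 / \<alpha> * (f xu yb - 1 / (2 * Lx) * (vnorm p)\<^sup>2)"
    using par by (intro mult_left_mono) auto
  also have "\<dots> = 2 / \<alpha> * f xu yb - \<eta>x * (vnorm p)\<^sup>2"
  proof -
    have "\<eta>x = 1 / (Lx * \<alpha>)" using par(1,5) Lx by (simp add: field_simps)
    then show ?thesis using par(1) Lx by (simp add: field_simps)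
  qed
  finally have D: "2 / \<alpha> * (f (xbar s') yb) + \<eta>x * (vnorm p)\<^sup>2 \<le> 2 / \<alpha> * f xu yb" by simp
  define F where "F = f (xbar s) (ybar s) - f xs ys"
  have F: "F \<ge> 0" using star(3)[OF st(2,4)] by (simp add: F_def)
  define N where "N = inverse \<eta>x * (vnorm (xk s - xs))\<^sup>2 + inverse \<eta>y * (vnorm (yk s - ys))\<^sup>2"
  have E: "2 * (1 - \<alpha>) / \<alpha> * (f (xbar s) (ybar s) - f xu yb) + 2 / \<alpha> * f xu yb + 2 * f xs ys - 2 * f xu yb
      - 2 / \<alpha> * f xs ys = 2 * (1 - \<alpha>) / \<alpha> * F"
  proof -
    have "2 * (1 - \<alpha>) / \<alpha> = 2 / \<alpha> - 2" using par(1) by (simp add: field_simps)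
    then show ?thesis unfolding F_def by (simp only:) (simp add: algebra_simps)
  qed
  have "potential f xs ys \<eta>x \<eta>y \<alpha> s' = (1 + \<alpha>) * (inverse \<eta>x * (vnorm (xk s' - xs))\<^sup>2)
      + (1 + \<alpha>) * (inverse \<eta>y * (vnorm (yk s' - ys))\<^sup>2) + 2 / \<alpha> * f (xbar s') yb - 2 / \<alpha> * f xs ys"
    by (simp add: potential_def yb_def distrib_left right_diff_distrib)
  also have "\<dots> \<le> N + 2 * (1 - \<alpha>) / \<alpha> * F"
    unfolding N_def using X Y Q S T D E by linarith
  finally have "(1 + \<alpha>) * potential f xs ys \<eta>x \<eta>y \<alpha> s' \<le> (1 + \<alpha>) * (N + 2 * (1 - \<alpha>) / \<alpha> * F)"
    using par by (intro mult_left_mono) auto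
  \<comment> \<open>The factor for \<open>F\<close> is
    \<open>(1 + \<alpha>) * (1 - \<alpha>)\<close>, which is at most 1; replacing it by 1 is allowed
    because \<open>F\<close> is nonnegative.\<close>
  also have "\<dots> = (1 + \<alpha>) * N + (1 - \<alpha>\<^sup>2) * (2 / \<alpha> * F)"
    by (simp add: power2_eq_square algebra_simps add_divide_distrib diff_divide_distrib)
  also have "\<dots> \<le> (1 + \<alpha>) * N + 1 * (2 / \<alpha> * F)"
    using par F by (intro add_left_mono mult_right_mono) auto
  also have "\<dots> = potential f xs ys \<eta>x \<eta>y \<alpha> s"
    by (simp add: potential_def N_def F_def)
  finally show ?thesis .
qed

section \<open>The inner budget and the acceptance criterion\<close>

text \<open>The budget is at least \<open>w\<close>, whose square is \<open>2 * C\<close> times a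
  quantity dominating \<open>max 1 (\<beta> * Ly)\<close>; this gives the factor 1/2. Rounding up
  \<open>max 1 w\<close> gives at most \<open>2 + w\<close>.\<close>

lemma inner_budget_bounds:
  assumes "C > 0" "\<beta> > 0"
  shows "inner_budget C Ly \<beta> \<ge> 1"
    and "C * max Ly (inverse \<beta>) / (real (inner_budget C Ly \<beta>))\<^sup>2 \<le> inverse \<beta> / 2"
    and "real (inner_budget C Ly \<beta>) \<le> 2 + sqrt (2 * C) * max 1 (sqrt (\<beta> * Ly))"
proof -
  define w where "w = sqrt (2 * C) * max 1 (sqrt (\<beta> * Ly))"
  define T where "T = inner_budget C Ly \<beta>"
  have w: "w \<ge> 0" using assms by (simp add: w_def max_def)
  have T: "real T = of_int \<lceil>max 1 w\<rceil>"
    by (simp add: T_def inner_budget_def w_def)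
  then have T1: "real T \<ge> max 1 w" by linarith
  then show "T \<ge> 1" by simp
  show "real T \<le> 2 + w"
    using T w by linarith
  have "max Ly (inverse \<beta>) = inverse \<beta> * max 1 (\<beta> * Ly)"
    using assms by (auto simp: max_def field_simps)
  moreover have "max 1 (\<beta> * Ly) \<le> (max 1 (sqrt (\<beta> * Ly)))\<^sup>2"
    by (auto simp: max_def)
  ultimately have "C * max Ly (inverse \<beta>) \<le> C * (inverse \<beta> * (max 1 (sqrt (\<beta> * Ly)))\<^sup>2)"
    using assms by (auto intro!: mult_left_mono)
  also have "\<dots> = inverse \<beta> / 2 * w\<^sup>2"
    using assms by (simp add: w_def power_mult_distrib)
  also have "\<dots> \<le> inverse \<beta> / 2 * (real T)\<^sup>2"
    using assms w T1 by (intro mult_left_mono power_mono) auto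
  finally show "C * max Ly (inverse \<beta>) / (real T)\<^sup>2 \<le> inverse \<beta> / 2"
    using T1 by (simp add: divide_le_eq)
qed

text \<open>The distance from \<open>yu\<close> to the minimizer is at most that from
  \<open>yu\<close> to the output plus \<open>\<beta>\<close> times the final gradient norm.
  Multiplied by \<open>inverse \<beta> / 2\<close>, the second part is half the gradient norm and is
  absorbed on the left.\<close>

lemma inner_run_meets_criterion:
  assumes "C > 0" and adm: "admissible dx dy Lx Ly \<mu>x \<mu>y f gx gy" and guar: "inner_guarantee C inner"
    and par: "\<eta>y > 0" "0 < \<alpha>" "\<alpha> < 1" and c: "xu \<in> carrier_vec dx" "yu \<in> carrier_vec dy"
  defines "\<beta> \<equiv> \<eta>y * \<alpha>"
  defines "T \<equiv> inner_budget C Ly \<beta>" and "g \<equiv> inner_grad gy xu yu \<beta>"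
  defines "P \<equiv> inner Ly \<beta> yu T"
  shows "result g P \<in> carrier_vec dy" and "evaluations g P \<le> T"
    and "vnorm (g (result g P)) \<le> inverse \<beta> * vnorm (result g P - yu)"
proof -
  have \<beta>: "\<beta> > 0" using par by (simp add: \<beta>_def)
  have Ly: "Ly > 0" using adm by (simp add: admissible_def)
  note T = inner_budget_bounds[OF assms(1) \<beta>, of Ly, folded T_def]
  define yb where "yb = result g P"
  note gc = inner_grad_carrier[OF adm c, of _ \<beta>, folded g_def]
  note ineqs = inner_obj_strongly_convex_smooth[OF adm c, of _ _ \<beta>, folded g_def]
  \<comment> \<open>The guarantee speaks only about a given minimizer, so one must be shown to
    exist.\<close>
  obtain ys where ys: "is_arg_min (inner_obj f xu yu \<beta>) (\<lambda>y. y \<in> carrier_vec dy) ys"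
    using strongly_convex_has_minimizer[OF _ gc ineqs(1)] \<beta> by auto
  then have ysc: "ys \<in> carrier_vec dy" by (simp add: is_arg_min_def)
  have g: "evaluations g P \<le> T \<and> yb \<in> carrier_vec dy \<and>
      vnorm (g yb) \<le> C * max Ly (inverse \<beta>) * vnorm (yu - ys) / (real T)\<^sup>2"
    using guar[unfolded inner_guarantee_def Let_def, rule_format, OF par(1) _ c T(1) adm] par ys
    unfolding yb_def g_def P_def \<beta>_def by simp
  then show "evaluations g P \<le> T" "yb \<in> carrier_vec dy" by simp_all
  then have ybc: "yb \<in> carrier_vec dy" by simp
  have "C * max Ly (inverse \<beta>) / (real T)\<^sup>2 * vnorm (yu - ys) \<le> inverse \<beta> / 2 * vnorm (yu - ys)"
    by (rule mult_right_mono[OF T(2) vnorm_nonneg])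
  then have 1: "vnorm (g yb) \<le> inverse \<beta> / 2 * vnorm (yu - ys)"
    using g unfolding times_divide_eq_left by linarith
  have 2: "inverse \<beta> * vnorm (yb - ys) \<le> vnorm (g yb)"
    by (rule strongly_convex_dist_minimizer[OF _ gc ineqs ys ybc]) (use \<beta> Ly in \<open>auto intro: add_pos_pos\<close>)
  have "vnorm (yu - ys) \<le> vnorm (yb - yu) + vnorm (yb - ys)"
    using vnorm_minus_triangle[OF c(2) ybc ysc] vnorm_minus_commute[OF ybc ysc] by simp
  then have "inverse \<beta> / 2 * vnorm (yu - ys) \<le> inverse \<beta> / 2 * (vnorm (yb - yu) + vnorm (yb - ys))"
    using \<beta> by (intro mult_left_mono) auto
  then show "vnorm (g yb) \<le> inverse \<beta> * vnorm (yb - yu)"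
    using 1 2 unfolding ring_distribs by linarith
qed

section \<open>Whole runs of BAM\<close>

text \<open>Dimensions and counts go through one induction, because the evaluation bound of the
  inner algorithm is available only at points of the right dimension. The summand 1 is the extra
  value of \<open>gy\<close> at the accepted point.\<close>

lemma bam_run_invariants:
  assumes "C > 0" and adm: "admissible dx dy Lx Ly \<mu>x \<mu>y f gx gy" and guar: "inner_guarantee C inner"
    and par: "\<eta>y > 0" "0 < \<alpha>" "\<alpha> < 1"
    and run: "bam_run dx dy gx gy inner C Ly \<eta>x \<eta>y \<alpha> s"
  shows "xk (s k) \<in> carrier_vec dx \<and> xbar (s k) \<in> carrier_vec dx \<and>
      yk (s k) \<in> carrier_vec dy \<and> ybar (s k) \<in> carrier_vec dy \<and>
      calcs_x (s k) = k \<and> calcs_y (s k) \<le> k * (inner_budget C Ly (\<eta>y * \<alpha>) + 1)" (is "?inv k")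
    and "bam_criterion gy \<eta>y \<alpha> (s k) (s (Suc k))"
proof -
  have step: "bam_step dx dy gx gy inner C Ly \<eta>x \<eta>y \<alpha> (s k) (s (Suc k))" for k
    using run by (simp add: bam_run_def)
  have uc: "x_under \<alpha> (s k) \<in> carrier_vec dx" "y_under \<alpha> (s k) \<in> carrier_vec dy"
    if "xk (s k) \<in> carrier_vec dx \<and> xbar (s k) \<in> carrier_vec dx \<and>
      yk (s k) \<in> carrier_vec dy \<and> ybar (s k) \<in> carrier_vec dy" for k
    using that by (simp_all add: x_under_def y_under_def)
  have inv: "?inv k" for k
  proof (induction k)
    case 0
    then show ?case using run by (simp add: bam_run_def)
  next
    case (Suc k)
    then have u: "x_under \<alpha> (s k) \<in> carrier_vec dx" "y_under \<alpha> (s k) \<in> carrier_vec dy"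
      using uc by blast+
    note inner = inner_run_meets_criterion[OF assms(1) adm guar par u]
    have yb: "ybar (s (Suc k)) \<in> carrier_vec dy"
      using step[of k] inner(1) by (simp add: bam_step_def Let_def)
    have "gx (x_under \<alpha> (s k)) (ybar (s (Suc k))) \<in> carrier_vec dx"
      using adm u yb by (auto simp: admissible_def has_gradients_def)
    then show ?case
      using step[of k] inner(2) Suc u yb by (simp add: bam_step_def Let_def)
  qed
  show "?inv k" by (rule inv)
  have "x_under \<alpha> (s k) \<in> carrier_vec dx" "y_under \<alpha> (s k) \<in> carrier_vec dy"
    using uc inv by blast+
  then show "bam_criterion gy \<eta>y \<alpha> (s k) (s (Suc k))"
    using inner_run_meets_criterion(3)[OF assms(1) adm guar par] step[of k]
    by (simp add: bam_step_def bam_criterion_def Let_def inner_grad_def)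
qed

lemma bam_run_potential:
  assumes "C > 0" and adm: "admissible dx dy Lx Ly \<mu>x \<mu>y f gx gy" and guar: "inner_guarantee C inner"
    and par: "0 < \<alpha>" "\<alpha> < 1" "\<eta>x > 0" "\<eta>y > 0" "\<eta>x * \<alpha> = 1 / Lx" "\<alpha> / \<eta>x = \<mu>x" "\<alpha> / \<eta>y = \<mu>y"
    and star: "xs \<in> carrier_vec dx" "ys \<in> carrier_vec dy"
      "\<And>x y. x \<in> carrier_vec dx \<Longrightarrow> y \<in> carrier_vec dy \<Longrightarrow> f xs ys \<le> f x y"
    and run: "bam_run dx dy gx gy inner C Ly \<eta>x \<eta>y \<alpha> s"
  shows "(1 + \<alpha>) ^ k * potential f xs ys \<eta>x \<eta>y \<alpha> (s k) \<le> potential f xs ys \<eta>x \<eta>y \<alpha> (s 0)"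
proof (induction k)
  case 0
  then show ?case by simp
next
  case (Suc k)
  note inv = bam_run_invariants(1)[OF assms(1) adm guar par(4,1,2) run]
  have "bam_step dx dy gx gy inner C Ly \<eta>x \<eta>y \<alpha> (s k) (s (Suc k))"
    using run by (simp add: bam_run_def)
  note step = this[unfolded bam_step_def Let_def]
  have "(1 + \<alpha>) * potential f xs ys \<eta>x \<eta>y \<alpha> (s (Suc k)) \<le> potential f xs ys \<eta>x \<eta>y \<alpha> (s k)"
    using bam_run_invariants(2)[OF assms(1) adm guar par(4,1,2) run, of k]
    by (intro bam_descent[OF adm par star]) (use inv[of k] inv[of "Suc k"] step in blast)+
  then have "(1 + \<alpha>) ^ k * ((1 + \<alpha>) * potential f xs ys \<eta>x \<eta>y \<alpha> (s (Suc k)))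
      \<le> (1 + \<alpha>) ^ k * potential f xs ys \<eta>x \<eta>y \<alpha> (s k)"
    using par by (intro mult_left_mono) auto
  then show ?case using Suc by (simp add: mult.assoc mult.left_commute)
qed

section \<open>Iteration count and total cost\<close>

text \<open>For \<alpha> at most 1, \<open>ln (1 + \<alpha>)\<close> is at least
  \<open>\<alpha> / 2\<close>, by \<open>ln z \<le> z - 1\<close> at
  \<open>z = inverse (1 + \<alpha>)\<close>.\<close>

lemma power_one_plus_ge:
  fixes \<alpha> t :: real
  assumes "0 < \<alpha>" "\<alpha> \<le> 1" "t > 0" "2 * ln t / \<alpha> \<le> real k"
  shows "t \<le> (1 + \<alpha>) ^ k"
proof -
  have "ln (inverse (1 + \<alpha>)) \<le> inverse (1 + \<alpha>) - 1"
    using assms by (intro ln_le_minus_one) simp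
  also have "\<dots> \<le> - (\<alpha> / 2)"
    using assms by (simp add: field_simps)
  finally have "\<alpha> / 2 \<le> ln (1 + \<alpha>)"
    using assms by (simp add: ln_inverse)
  then have "real k * (\<alpha> / 2) \<le> real k * ln (1 + \<alpha>)"
    by (rule mult_left_mono) simp
  moreover have "ln t \<le> real k * (\<alpha> / 2)"
    using assms by (simp add: field_simps)
  ultimately have "ln t \<le> ln ((1 + \<alpha>) ^ k)"
    using assms by (simp add: ln_realpow)
  then show ?thesis using assms by simp
qed

text \<open>As \<epsilon> is at most 1/2, its negative logarithm is at least 1/2, so the rounded
  quantity is at least 1 and rounding up at most doubles it.\<close>

lemma ceiling_ln_bound:
  fixes \<alpha> \<epsilon> :: real
  assumes "0 < \<alpha>" "\<alpha> \<le> 1" "0 < \<epsilon>" "\<epsilon> \<le> 1 / 2"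
  shows "real (nat \<lceil>2 * ln (1 / \<epsilon>) / \<alpha>\<rceil>) \<le> 4 * (1 / \<alpha>) * ln (1 / \<epsilon>)"
proof -
  have "ln (1 / \<epsilon>) \<ge> 1 - \<epsilon>"
    using ln_le_minus_one[of \<epsilon>] assms by (simp add: ln_div)
  then have l: "ln (1 / \<epsilon>) \<ge> 1 / 2" using assms by simp
  then have "2 * ln (1 / \<epsilon>) / \<alpha> \<ge> 1"
    using assms by (simp add: le_divide_eq)
  then have "real (nat \<lceil>2 * ln (1 / \<epsilon>) / \<alpha>\<rceil>) \<le> 2 * (2 * ln (1 / \<epsilon>) / \<alpha>)" by linarith
  then show ?thesis by simp
qed

theorem mainTheorem2:
  fixes C :: real
  assumes "C > 0"
  shows "\<exists>c>0. \<forall>inner. inner_guarantee C inner \<longrightarrow>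
    (\<forall>dx dy Lx Ly \<mu>x \<mu>y f gx gy xs ys \<epsilon> \<alpha> \<eta>x \<eta>y.
      admissible dx dy Lx Ly \<mu>x \<mu>y f gx gy \<longrightarrow>
      is_arg_min (\<lambda>(x, y). f x y) (\<lambda>(x, y). x \<in> carrier_vec dx \<and> y \<in> carrier_vec dy) (xs, ys) \<longrightarrow>
      0 < \<epsilon> \<longrightarrow> \<epsilon> \<le> 1 / 2 \<longrightarrow>
      \<alpha> = sqrt (\<mu>x / Lx) \<longrightarrow> \<eta>x = 1 / sqrt (\<mu>x * Lx) \<longrightarrow> \<eta>y = 1 / \<mu>y * sqrt (\<mu>x / Lx) \<longrightarrow>
      (\<exists>K. \<forall>s. bam_run dx dy gx gy inner C Ly \<eta>x \<eta>y \<alpha> s \<longrightarrow>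
        (\<forall>k. bam_criterion gy \<eta>y \<alpha> (s k) (s (Suc k))) \<and>
        potential f xs ys \<eta>x \<eta>y \<alpha> (s K) \<le> \<epsilon> * potential f xs ys \<eta>x \<eta>y \<alpha> (s 0) \<and>
        real (calcs_x (s K)) \<le> c * sqrt (Lx / \<mu>x) * ln (1 / \<epsilon>) \<and>
        real (calcs_y (s K)) \<le> c * max (sqrt (Lx / \<mu>x)) (sqrt (Ly / \<mu>y)) * ln (1 / \<epsilon>)))"
proof (intro exI[of _ "4 * (3 + sqrt (2 * C))"] conjI allI impI)
  \<comment> \<open>The factor 4 comes from \<open>ceiling_ln_bound\<close>, the factor
    \<open>3 + sqrt (2 * C)\<close> from the number of values of \<open>gy\<close> per step relative
    to \<open>M\<close>.\<close>
  show "4 * (3 + sqrt (2 * C)) > 0" using assms by (simp add: add_pos_pos)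
  fix inner dx dy Lx Ly \<mu>x \<mu>y f gx gy xs ys and \<epsilon> \<alpha> \<eta>x \<eta>y :: real
  assume guar: "inner_guarantee C inner" and adm: "admissible dx dy Lx Ly \<mu>x \<mu>y f gx gy"
    and min: "is_arg_min (\<lambda>(x, y). f x y) (\<lambda>(x, y). x \<in> carrier_vec dx \<and> y \<in> carrier_vec dy) (xs, ys)"
    and \<epsilon>: "0 < \<epsilon>" "\<epsilon> \<le> 1 / 2"
    and \<alpha>: "\<alpha> = sqrt (\<mu>x / Lx)" and \<eta>x: "\<eta>x = 1 / sqrt (\<mu>x * Lx)"
    and \<eta>y: "\<eta>y = 1 / \<mu>y * sqrt (\<mu>x / Lx)"
  have pos: "Lx > 0" "Ly > 0" "\<mu>x > 0" "\<mu>y > 0" "\<mu>x < Lx" using adm by (auto simp: admissible_def)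
  have par: "0 < \<alpha>" "\<alpha> < 1" "\<eta>x > 0" "\<eta>y > 0"
    using pos by (simp_all add: \<alpha> \<eta>x \<eta>y)
  have \<eta>y': "\<alpha> / \<eta>y = \<mu>y" using pos by (simp add: \<alpha> \<eta>y)
  have \<eta>x': "\<eta>x * \<alpha> = 1 / Lx" "\<alpha> / \<eta>x = \<mu>x"
    using pos by (simp_all add: \<alpha> \<eta>x real_sqrt_divide real_sqrt_mult field_simps)
  have star: "xs \<in> carrier_vec dx" "ys \<in> carrier_vec dy"
      "\<And>x y. x \<in> carrier_vec dx \<Longrightarrow> y \<in> carrier_vec dy \<Longrightarrow> f xs ys \<le> f x y"
    using min by (force simp: is_arg_min_def not_less)+
  have inv\<alpha>: "1 / \<alpha> = sqrt (Lx / \<mu>x)" using pos by (simp add: \<alpha> real_sqrt_divide)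
  \<comment> \<open>This count depends only on \<alpha> and \<epsilon>, hence serves all runs at
    once.\<close>
  define K where "K = nat \<lceil>2 * ln (1 / \<epsilon>) / \<alpha>\<rceil>"
  have K_le: "real K \<le> 4 * (1 / \<alpha>) * ln (1 / \<epsilon>)"
    unfolding K_def using par \<epsilon> by (intro ceiling_ln_bound) auto
  have K_ge: "1 / \<epsilon> \<le> (1 + \<alpha>) ^ K"
    by (rule power_one_plus_ge) (use par \<epsilon> in \<open>auto simp: K_def real_nat_ceiling_ge\<close>)
  have ln0: "ln (1 / \<epsilon>) \<ge> 0" using \<epsilon> by simp
  define M where "M = max 1 (sqrt (\<eta>y * \<alpha> * Ly))"
  have M: "1 / \<alpha> * M = max (sqrt (Lx / \<mu>x)) (sqrt (Ly / \<mu>y))"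
  proof -
    have "\<eta>y * \<alpha> * Ly = \<alpha>\<^sup>2 * (Ly / \<mu>y)" using pos \<eta>y' par by (simp add: field_simps power2_eq_square)
    then have "sqrt (\<eta>y * \<alpha> * Ly) = \<alpha> * sqrt (Ly / \<mu>y)" using par by (simp only: real_sqrt_mult real_sqrt_abs)
    then show ?thesis unfolding M_def inv\<alpha>[symmetric] using par by (simp add: max_mult_distrib_left)
  qed
  let ?T = "inner_budget C Ly (\<eta>y * \<alpha>)"
  have T: "real (?T + 1) \<le> (3 + sqrt (2 * C)) * M"
    using inner_budget_bounds(3)[OF assms, of "\<eta>y * \<alpha>" Ly] par
    by (simp add: M_def[symmetric] distrib_right) (simp add: M_def)
  show "\<exists>K. \<forall>s. bam_run dx dy gx gy inner C Ly \<eta>x \<eta>y \<alpha> s \<longrightarrow>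
        (\<forall>k. bam_criterion gy \<eta>y \<alpha> (s k) (s (Suc k))) \<and>
        potential f xs ys \<eta>x \<eta>y \<alpha> (s K) \<le> \<epsilon> * potential f xs ys \<eta>x \<eta>y \<alpha> (s 0) \<and>
        real (calcs_x (s K)) \<le> 4 * (3 + sqrt (2 * C)) * sqrt (Lx / \<mu>x) * ln (1 / \<epsilon>) \<and>
        real (calcs_y (s K)) \<le> 4 * (3 + sqrt (2 * C)) * max (sqrt (Lx / \<mu>x)) (sqrt (Ly / \<mu>y)) * ln (1 / \<epsilon>)"
  proof (intro exI[of _ K] allI impI conjI)
    fix s assume run: "bam_run dx dy gx gy inner C Ly \<eta>x \<eta>y \<alpha> s"
    note inv = bam_run_invariants[OF assms adm guar par(4,1,2) run]
    show "bam_criterion gy \<eta>y \<alpha> (s k) (s (Suc k))" for k by (rule inv(2))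
    define \<Psi> where "\<Psi> k = potential f xs ys \<eta>x \<eta>y \<alpha> (s k)" for k
    \<comment> \<open>Nonnegativity lets the lower bound \<open>K_ge\<close> on the contraction
      factor be multiplied by the potential.\<close>
    have "\<Psi> K \<ge> 0"
      unfolding \<Psi>_def potential_def using par inv(1)[of K] star(3) by simp
    then have "1 / \<epsilon> * \<Psi> K \<le> (1 + \<alpha>) ^ K * \<Psi> K"
      using K_ge by (rule mult_right_mono[rotated])
    also have "\<dots> \<le> \<Psi> 0"
      unfolding \<Psi>_def by (rule bam_run_potential[OF assms adm guar par \<eta>x' \<eta>y' star run])
    finally have "\<Psi> K \<le> \<epsilon> * \<Psi> 0" using \<epsilon> by (simp add: field_simps)
    then show "potential f xs ys \<eta>x \<eta>y \<alpha> (s K) \<le> \<epsilon> * potential f xs ys \<eta>x \<eta>y \<alpha> (s 0)"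
      by (simp add: \<Psi>_def)
    \<comment> \<open>There is one value of \<open>gx\<close> per step; the factor is enlarged only
      to share one constant with the other count.\<close>
    have "real (calcs_x (s K)) \<le> 1 * (4 * sqrt (Lx / \<mu>x) * ln (1 / \<epsilon>))"
      using inv(1)[of K] K_le inv\<alpha> by simp
    also have "\<dots> \<le> (3 + sqrt (2 * C)) * (4 * sqrt (Lx / \<mu>x) * ln (1 / \<epsilon>))"
      using assms pos ln0 by (intro mult_right_mono mult_nonneg_nonneg) auto
    finally show "real (calcs_x (s K)) \<le> 4 * (3 + sqrt (2 * C)) * sqrt (Lx / \<mu>x) * ln (1 / \<epsilon>)"
      by (simp only: mult.assoc mult.left_commute)
    have "real (calcs_y (s K)) \<le> real (K * (?T + 1))"
      using inv(1)[of K] by (simp only: of_nat_le_iff)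
    also have "\<dots> = real K * real (?T + 1)" by (rule of_nat_mult)
    also have "\<dots> \<le> (4 * (1 / \<alpha>) * ln (1 / \<epsilon>)) * ((3 + sqrt (2 * C)) * M)"
      using K_le T ln0 par by (intro mult_mono) auto
    also have "\<dots> = 4 * (3 + sqrt (2 * C)) * (1 / \<alpha> * M) * ln (1 / \<epsilon>)"
      by (simp only: mult_ac)
    finally show "real (calcs_y (s K))
        \<le> 4 * (3 + sqrt (2 * C)) * max (sqrt (Lx / \<mu>x)) (sqrt (Ly / \<mu>y)) * ln (1 / \<epsilon>)"
      unfolding M .
  qed
qed

end
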